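(* Suppose $n \geq 3$, $A \in \mathcal{M}_n^{+}$ has factor width $2$, and each diagonal entry of $A$ belongs to some $3 \times 3$ principal submatrix of $A$ with all entries non-zero. Then $\mathrm{fran}_2(A) = \mathrm{nnzu}(A)$.
   Context: Let $\mathbb{F} \in \{\mathbb{R},\mathbb{C}\}$ (the result holds for either field). $\mathcal{M}_n^{+}$ denotes the set of $n \times n$ positive semidefinite (real symmetric if $\mathbb{F}=\mathbb{R}$, Hermitian if $\mathbb{F}=\mathbb{C}$) matrices over $\mathbb{F}$. The factor width of $A \in \mathcal{M}_n^{+}$ is the smallest positive integer $k$ such that $A = \sum_{j=1}^r \mathbf{v}_j\mathbf{v}_j^*$ for some $r$ and some $\mathbf{v}_1,\ldots,\mathbf{v}_r \in \mathbb{F}^n$, each with at most $k$ non-zero entries. If $A$ has factor width at most $k$, $\mathrm{fran}_k(A)$ (the factor-width-$k$ rank) is the least integer $r$ for which such a decomposition with vectors having at most $k$ non-zero entries exists. $\mathrm{nnzu}(A)$ is the number of non-zero entries of $A$ strictly above its main diagonal. *)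

theory Defs
  imports
    "HOL-Library.Extended_Nat"
    "Jordan_Normal_Form.Schur_Decomposition"
    "Jordan_Normal_Form.DL_Submatrix"
begin

(* All notions are polymorphic over conjugatable ordered fields. They are meant for real
   (where conjugate is the identity, so mat_adjoint is the transpose) and complex (where
   0 <= z means that z is real and nonnegative). *)

definition psd_mats :: "nat \<Rightarrow> 'a :: conjugatable_ordered_field mat set" where
  "psd_mats n = {A \<in> carrier_mat n n. mat_adjoint A = A \<and>
     (\<forall>x \<in> carrier_vec n. 0 \<le> (A *\<^sub>v x) \<bullet>c x)}"

definition vec_nnz :: "'a :: zero vec \<Rightarrow> nat" where
  "vec_nnz v = card {i. i < dim_vec v \<and> v $ i \<noteq> 0}"

(* the rank-one matrix v v* *)
definition self_outer :: "'a :: conjugatable_ring vec \<Rightarrow> 'a mat" where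
  "self_outer v = mat (dim_vec v) (dim_vec v) (\<lambda>(i, j). v $ i * conjugate (v $ j))"

definition self_outer_sum :: "nat \<Rightarrow> 'a :: conjugatable_ring vec list \<Rightarrow> 'a mat" where
  "self_outer_sum n vs = foldr (\<lambda>v B. self_outer v + B) vs (0\<^sub>m n n)"

definition width_decomp :: "nat \<Rightarrow> 'a :: conjugatable_ring mat \<Rightarrow> 'a vec list \<Rightarrow> bool" where
  "width_decomp k A vs \<longleftrightarrow>
     (\<forall>v \<in> set vs. v \<in> carrier_vec (dim_row A) \<and> vec_nnz v \<le> k) \<and>
     A = self_outer_sum (dim_row A) vs"

(* Both minima are taken in enat, so that they are infinity, rather than an unspecified
   number, when no decomposition exists. *)

definition factor_width :: "'a :: conjugatable_ring mat \<Rightarrow> enat" where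
  "factor_width A = Inf {enat k | k. 1 \<le> k \<and> (\<exists>vs. width_decomp k A vs)}"

definition fran :: "nat \<Rightarrow> 'a :: conjugatable_ring mat \<Rightarrow> enat" where
  "fran k A = Inf {enat (length vs) | vs. width_decomp k A vs}"

definition nnzu :: "'a :: zero mat \<Rightarrow> nat" where
  "nnzu A = card {(i, j). i < j \<and> i < dim_row A \<and> j < dim_col A \<and> A $$ (i, j) \<noteq> 0}"

(* The principal submatrix of A on an index set I contains the i-th diagonal entry of A
   iff i is in I. *)
definition diag_in_full_principal3 :: "'a :: zero mat \<Rightarrow> nat \<Rightarrow> bool" where
  "diag_in_full_principal3 A i \<longleftrightarrow>
     (\<exists>I. I \<subseteq> {..<dim_row A} \<and> card I = 3 \<and> i \<in> I \<and> 0 \<notin> elements_mat (submatrix A I I))"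

end

theory Submission
  imports Defs "HOL-Analysis.Convex"
begin

text \<open>
  Regard the non-zero off-diagonal entries of \<open>A\<close> as the edges of a graph on the index set.
  A vector \<open>v\<close> with at most two non-zero entries contributes to at most one edge of the graph, so
  every width-two decomposition has at least as many vectors as there are edges
  (\<open>nnzu_le_length_width_decomp\<close>).

  For the converse, a decomposition that spends exactly one vector on each edge amounts to a
  splitting of the diagonal: numbers \<open>y i j \<ge> 0\<close> such that \<open>y i j * y j i = \<bar>A i j\<bar>\<^sup>2\<close> for every
  edge and such that the numbers at a vertex \<open>i\<close> add up to \<open>A i i\<close>.  The vector of the edge
  \<open>{i, j}\<close> then has entries of modulus \<open>sqrt (y i j)\<close> and \<open>sqrt (y j i)\<close>.  Collecting the vectors of
  a given width-two decomposition by their supports and applying the Cauchy--Schwarz inequality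
  edge by edge gives a splitting with both conditions relaxed to inequalities, and scaling down
  makes the products exact (\<open>edge_split_below\<close>).  What remains is a non-negative deficit at each
  vertex.

  The triangles are used to remove the deficits.  Let \<open>i, j, k\<close> be a triangle and let \<open>y i j\<close> grow.
  The products being prescribed, \<open>y j i\<close> shrinks; keeping the total at \<open>j\<close> fixed makes
  \<open>y j k\<close> grow, so \<open>y k j\<close> shrinks; keeping the total at \<open>k\<close> fixed makes \<open>y k i\<close> grow, so \<open>y i k\<close>
  shrinks but stays positive.  The total at \<open>i\<close> therefore tends to infinity, and by continuity
  it takes every value above its initial one, while no other total has changed
  (\<open>raise_triangle\<close>).  Hence the deficits can be removed one vertex after the other.
\<close>

section \<open>Splittings of edge weights\<close>

text \<open>
  The value \<open>y i j\<close> is the share at \<open>i\<close> of the edge \<open>{i, j}\<close>.  Non-edges are pairs of weight zero;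
  their shares vanish, so that totals can be taken over all other vertices.
\<close>
definition edge_split :: "'v set \<Rightarrow> ('v \<Rightarrow> 'v \<Rightarrow> real) \<Rightarrow> ('v \<Rightarrow> 'v \<Rightarrow> real) \<Rightarrow> bool" where
  "edge_split V c y \<longleftrightarrow> (\<forall>i\<in>V. \<forall>j\<in>V. i \<noteq> j \<longrightarrow>
     0 \<le> y i j \<and> y i j * y j i = c i j \<and> (c i j = 0 \<longrightarrow> y i j = 0))"

definition share_total :: "'v set \<Rightarrow> ('v \<Rightarrow> 'v \<Rightarrow> real) \<Rightarrow> 'v \<Rightarrow> real" where
  "share_total V y i = (\<Sum>j\<in>V - {i}. y i j)"

text \<open>
  Scaling both shares of an edge by the square root of the ratio of the prescribed product to the
  actual one makes the product exact.  The factor is at most one, so no total increases.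
\<close>
lemma edge_split_below:
  assumes "finite V"
    and nonneg: "\<And>i j. i \<in> V \<Longrightarrow> j \<in> V \<Longrightarrow> i \<noteq> j \<Longrightarrow> 0 \<le> x i j"
    and c_nonneg: "\<And>i j. i \<in> V \<Longrightarrow> j \<in> V \<Longrightarrow> i \<noteq> j \<Longrightarrow> 0 \<le> c i j"
    and le: "\<And>i j. i \<in> V \<Longrightarrow> j \<in> V \<Longrightarrow> i \<noteq> j \<Longrightarrow> c i j \<le> x i j * x j i"
    and sym: "\<And>i j. i \<in> V \<Longrightarrow> j \<in> V \<Longrightarrow> i \<noteq> j \<Longrightarrow> c i j = c j i"
  obtains y where "edge_split V c y" "\<And>i. i \<in> V \<Longrightarrow> share_total V y i \<le> share_total V x i"
proof -
  define f where "f i j = sqrt (c i j / (x i j * x j i))" for i j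
  define y where "y i j = x i j * f i j" for i j
  have f01: "0 \<le> f i j" "f i j \<le> 1" "f i j = f j i" if "i \<in> V" "j \<in> V" "i \<noteq> j" for i j
    using nonneg[of i j] nonneg[of j i] c_nonneg[of i j] le[of i j] sym[of i j] that
    by (auto simp: f_def mult.commute divide_le_eq_1 order.order_iff_strict)
  have prod: "y i j * y j i = c i j" if "i \<in> V" "j \<in> V" "i \<noteq> j" for i j
  proof -
    let ?p = "x i j * x j i"
    have "y i j * y j i = ?p * (f i j)\<^sup>2"
      using f01(3)[OF that] by (simp add: y_def power2_eq_square)
    also have "(f i j)\<^sup>2 = c i j / ?p"
      unfolding f_def using nonneg[of i j] nonneg[of j i] c_nonneg[of i j] that by simp
    also have "?p * (c i j / ?p) = c i j"
      using le[OF that] c_nonneg[OF that] by (cases "?p = 0") auto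
    finally show ?thesis .
  qed
  have "edge_split V c y"
    unfolding edge_split_def using prod f01(1) nonneg by (auto simp: y_def f_def)
  moreover have "share_total V y i \<le> share_total V x i" if "i \<in> V" for i
    unfolding share_total_def y_def using that f01 nonneg
    by (intro sum_mono) (auto intro: mult_left_le)
  ultimately show ?thesis using that by blast
qed

section \<open>Raising one total inside a triangle\<close>

text \<open>
  Once \<open>u\<close> is the new share of the edge \<open>{i, j}\<close> at \<open>i\<close>, the prescribed products and the fixed
  totals at \<open>j\<close> and \<open>k\<close> determine the other five shares, and the total at \<open>i\<close> becomes a
  continuous function of \<open>u\<close>.
\<close>
lemma raise_triangle:
  fixes xij :: real
  assumes pos: "0 < xij" "0 < xik" "0 < xji" "0 < xjk" "0 < xki" "0 < xkj" and "0 \<le> d"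
  obtains yij yik yji yjk yki ykj :: real where
    "0 < yij" "0 < yik" "0 < yji" "0 < yjk" "0 < yki" "0 < ykj"
    "yij * yji = xij * xji" "yjk * ykj = xjk * xkj" "yki * yik = xki * xik"
    "yij + yik = xij + xik + d" "yji + yjk = xji + xjk" "yki + ykj = xki + xkj"
proof -
  define yji where "yji u = xij * xji / u" for u
  define yjk where "yjk u = xji + xjk - yji u" for u
  define ykj where "ykj u = xjk * xkj / yjk u" for u
  define yki where "yki u = xki + xkj - ykj u" for u
  define yik where "yik u = xki * xik / yki u" for u
  define b where "b = xij + xik + d"
  have ji: "0 < yji u" and jk: "xjk \<le> yjk u" and kj: "0 < ykj u" and ki: "xki \<le> yki u"
    and ik: "0 < yik u" if "xij \<le> u" for u
  proof -
    have "0 < u" using that pos by simp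
    then show "0 < yji u" using pos by (simp add: yji_def)
    have "xij * xji \<le> u * xji" using that pos by (intro mult_right_mono) auto
    then have "yji u \<le> xji" using \<open>0 < u\<close> by (simp add: yji_def divide_le_eq mult.commute)
    then show jk': "xjk \<le> yjk u" by (simp add: yjk_def)
    then have "0 < yjk u" using pos by simp
    then show "0 < ykj u" using pos by (simp add: ykj_def)
    have "xjk * xkj \<le> yjk u * xkj" using jk' pos by (intro mult_right_mono) auto
    then have "ykj u \<le> xkj"
      using \<open>0 < yjk u\<close> by (simp add: ykj_def divide_le_eq mult.commute)
    then show "xki \<le> yki u" by (simp add: yki_def)
    then show "0 < yik u" using pos by (simp add: yik_def)
  qed
  have cont: "continuous_on {xij..b} (\<lambda>u. u + yik u)"
  proof -
    have 1: "continuous_on {xij..b} yji" unfolding yji_def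
      using pos by (intro continuous_intros) auto
    have 2: "continuous_on {xij..b} yjk" unfolding yjk_def
      by (intro continuous_intros 1)
    have 3: "continuous_on {xij..b} ykj" unfolding ykj_def
      using pos jk by (intro continuous_intros 2) force
    have 4: "continuous_on {xij..b} yki" unfolding yki_def
      by (intro continuous_intros 3)
    show ?thesis unfolding yik_def
      using pos ki by (intro continuous_intros 4) force
  qed
  have "yji xij = xji" using pos by (simp add: yji_def)
  then have "yjk xij = xjk" by (simp add: yjk_def)
  then have "ykj xij = xkj" using pos by (simp add: ykj_def)
  then have "yki xij = xki" by (simp add: yki_def)
  then have "yik xij = xik" using pos by (simp add: yik_def)
  moreover have "xij \<le> b" using pos \<open>0 \<le> d\<close> by (simp add: b_def)
  moreover from this have "b \<le> b + yik b" using ik[of b] by simp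
  \<comment> \<open>At \<open>u = b\<close> the first share alone is already as large as the total that is wanted.\<close>
  ultimately obtain u where u: "xij \<le> u" "u + yik u = b"
    using IVT'[of "\<lambda>u. u + yik u" xij b b] cont \<open>0 \<le> d\<close> by (auto simp: b_def)
  have pos': "0 < yjk u" "0 < yki u" "0 < u" using jk[OF u(1)] ki[OF u(1)] u(1) pos by auto
  show ?thesis
    by (rule that[of u "yik u" "yji u" "yjk u" "yki u" "ykj u"])
      (use ji[OF u(1)] kj[OF u(1)] ik[OF u(1)] pos' u(2) in
        \<open>auto simp: yji_def yjk_def ykj_def yki_def yik_def b_def\<close>)
qed

lemma sum_change_two:
  fixes f g :: "'v \<Rightarrow> real"
  assumes "finite S" "j \<in> S" "k \<in> S" "j \<noteq> k"
    and "\<And>l. l \<in> S \<Longrightarrow> l \<noteq> j \<Longrightarrow> l \<noteq> k \<Longrightarrow> g l = f l"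
  shows "sum g S = sum f S - (f j + f k) + (g j + g k)"
proof -
  have split: "sum h S = h j + h k + sum h (S - {j} - {k})" for h :: "'v \<Rightarrow> real"
    using assms by (simp add: sum.remove[of S j] sum.remove[of "S - {j}" k])
  have "sum g (S - {j} - {k}) = sum f (S - {j} - {k})"
    using assms by (intro sum.cong) auto
  with split[of f] split[of g] show ?thesis by simp
qed

lemma edge_split_raise:
  assumes "finite V" and split: "edge_split V c y"
    and ijk: "i \<in> V" "j \<in> V" "k \<in> V" "i \<noteq> j" "i \<noteq> k" "j \<noteq> k"
    and edges: "c i j \<noteq> 0" "c i k \<noteq> 0" "c j k \<noteq> 0" and "0 \<le> d"
    and sym: "\<And>i j. i \<in> V \<Longrightarrow> j \<in> V \<Longrightarrow> i \<noteq> j \<Longrightarrow> c i j = c j i"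
  obtains z where "edge_split V c z" "share_total V z i = share_total V y i + d"
    "\<And>l. l \<noteq> i \<Longrightarrow> share_total V z l = share_total V y l"
proof -
  have *: "0 \<le> y a b \<and> y a b * y b a = c a b \<and> (c a b = 0 \<longrightarrow> y a b = 0)"
    if "a \<in> V" "b \<in> V" "a \<noteq> b" for a b
    using split that by (auto simp: edge_split_def)
  have pos: "0 < y a b" if "a \<in> V" "b \<in> V" "a \<noteq> b" "c a b \<noteq> 0" for a b
  proof -
    have "y a b \<noteq> 0" using *[OF that(1-3)] that(4) by auto
    then show ?thesis using *[OF that(1-3)] by simp
  qed
  have edges': "c j i \<noteq> 0" "c k i \<noteq> 0" "c k j \<noteq> 0"
    using edges ijk by (simp_all add: sym[of j i] sym[of k i] sym[of k j])
  note pos6 = pos[OF ijk(1,2,4) edges(1)] pos[OF ijk(1,3,5) edges(2)]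
    pos[OF ijk(2,1) ijk(4)[symmetric] edges'(1)] pos[OF ijk(2,3,6) edges(3)]
    pos[OF ijk(3,1) ijk(5)[symmetric] edges'(2)] pos[OF ijk(3,2) ijk(6)[symmetric] edges'(3)]
  obtain yij yik yji yjk yki ykj where new:
    "0 < yij" "0 < yik" "0 < yji" "0 < yjk" "0 < yki" "0 < ykj"
    "yij * yji = y i j * y j i" "yjk * ykj = y j k * y k j" "yki * yik = y k i * y i k"
    "yij + yik = y i j + y i k + d" "yji + yjk = y j i + y j k" "yki + ykj = y k i + y k j"
    by (rule raise_triangle[OF pos6 \<open>0 \<le> d\<close>])
  define z where "z = y(i := (y i)(j := yij, k := yik), j := (y j)(i := yji, k := yjk),
    k := (y k)(i := yki, j := ykj))"
  have z: "z i j = yij" "z i k = yik" "z j i = yji" "z j k = yjk" "z k i = yki" "z k j = ykj"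
    using ijk by (auto simp: z_def)
  have z_other: "z a b = y a b"
    if "\<not> (a \<in> {i, j, k} \<and> b \<in> {i, j, k})" for a b
    using that by (auto simp: z_def)
  have "0 \<le> z a b \<and> z a b * z b a = c a b \<and> (c a b = 0 \<longrightarrow> z a b = 0)"
    if ab: "a \<in> V" "b \<in> V" "a \<noteq> b" for a b
  proof (cases "a \<in> {i, j, k} \<and> b \<in> {i, j, k}")
    case False
    then have "z a b = y a b" "z b a = y b a" using z_other by blast+
    then show ?thesis using *[OF ab] by simp
  next
    case True
    have prods: "yij * yji = c i j" "yji * yij = c j i" "yjk * ykj = c j k" "ykj * yjk = c k j"
      "yki * yik = c k i" "yik * yki = c i k"
      using new(7-9) *[of i j] *[of j i] *[of j k] *[of k j] *[of k i] *[of i k] ijk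
      by (metis mult.commute)+
    have "c a b \<noteq> 0" using True ab(3) edges edges' by blast
    then show ?thesis using True ab(3) z new prods by (auto simp: less_imp_le)
  qed
  then have "edge_split V c z" by (auto simp: edge_split_def)
  moreover have "share_total V z i = share_total V y i + d"
    using sum_change_two[of "V - {i}" j k "z i" "y i"] assms(1) ijk new z z_other
    by (auto simp: share_total_def)
  moreover have "share_total V z l = share_total V y l" if li: "l \<noteq> i" for l
  proof -
    consider "l = j" | "l = k" | "l \<notin> {i, j, k}" using li by blast
    then show ?thesis
    proof cases
      case 1
      then show ?thesis
        using sum_change_two[of "V - {j}" i k "z j" "y j"] assms(1) ijk new z z_other
        by (auto simp: share_total_def)
    next
      case 2
      then show ?thesis
        using sum_change_two[of "V - {k}" i j "z k" "y k"] assms(1) ijk new z z_other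
        by (auto simp: share_total_def)
    next
      case 3
      then show ?thesis using z_other by (simp add: share_total_def)
    qed
  qed
  ultimately show ?thesis using that by blast
qed

text \<open>
  Raising the total at a vertex leaves all other totals alone, so the vertices can be treated
  one at a time.
\<close>
lemma edge_split_exact_totals:
  assumes "finite V" and split: "edge_split V c x"
    and le: "\<And>i. i \<in> V \<Longrightarrow> share_total V x i \<le> t i"
    and sym: "\<And>i j. i \<in> V \<Longrightarrow> j \<in> V \<Longrightarrow> i \<noteq> j \<Longrightarrow> c i j = c j i"
    and triangle: "\<And>i. i \<in> V \<Longrightarrow> \<exists>j\<in>V. \<exists>k\<in>V. i \<noteq> j \<and> i \<noteq> k \<and> j \<noteq> k \<and>
      c i j \<noteq> 0 \<and> c i k \<noteq> 0 \<and> c j k \<noteq> 0"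
  obtains y where "edge_split V c y" "\<And>i. i \<in> V \<Longrightarrow> share_total V y i = t i"
proof -
  have "\<exists>y. edge_split V c y \<and> (\<forall>i\<in>V. share_total V y i \<le> t i) \<and> (\<forall>i\<in>W. share_total V y i = t i)"
    if "finite W" "W \<subseteq> V" for W
    using that
  proof (induction W rule: finite_induct)
    case empty
    then show ?case using split le by auto
  next
    case (insert i W)
    then obtain y where y: "edge_split V c y" "\<forall>i\<in>V. share_total V y i \<le> t i"
      "\<forall>i\<in>W. share_total V y i = t i" by auto
    have i: "i \<in> V" using insert by auto
    from triangle[OF i] obtain j k where jk: "j \<in> V" "k \<in> V" "i \<noteq> j" "i \<noteq> k" "j \<noteq> k"
      "c i j \<noteq> 0" "c i k \<noteq> 0" "c j k \<noteq> 0" by blast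
    obtain z where z: "edge_split V c z"
      "share_total V z i = share_total V y i + (t i - share_total V y i)"
      "\<And>l. l \<noteq> i \<Longrightarrow> share_total V z l = share_total V y l"
      by (rule edge_split_raise[OF assms(1) y(1) i jk, where d = "t i - share_total V y i"])
        (use y(2) i sym in auto)
    have "share_total V z i = t i" using z(2) by simp
    moreover have "share_total V z l \<le> t l" if "l \<in> V" for l
      using y(2) z(3)[of l] \<open>share_total V z i = t i\<close> that by (cases "l = i") auto
    moreover have "share_total V z l = t l" if "l \<in> W" for l
      using y(3) z(3)[of l] \<open>share_total V z i = t i\<close> that by (cases "l = i") auto
    ultimately show ?case using z(1) by blast
  qed
  from this[OF assms(1)] show ?thesis using that by auto
qed

section \<open>Fields with a norm given by conjugation\<close>

text \<open>
  The argument for real and for complex matrices is the same.  It uses of the scalars only that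
  they contain the reals and that \<open>a * conjugate a\<close> is the square of the modulus.  The axiom is
  stated with scalar multiplication, an operation of the class, because \<open>of_real\<close> is a constant
  defined for all real algebras and cannot occur in it.
\<close>
class norm_conjugate_field = conjugatable_field + real_normed_field +
  assumes mult_conjugate_scaleR: "a * conjugate a = (norm a)\<^sup>2 *\<^sub>R 1"

lemma mult_conjugate: "a * conjugate a = (of_real ((norm a)\<^sup>2) :: 'a :: norm_conjugate_field)"
  by (simp add: mult_conjugate_scaleR of_real_def)

instance real :: norm_conjugate_field
  by standard (simp add: power2_eq_square)

instance complex :: norm_conjugate_field
  by standard (simp add: complex_mult_cnj cmod_power2 scaleR_conv_of_real)

lemma norm_conjugate [simp]: "norm (conjugate (a :: 'a :: norm_conjugate_field)) = norm a"
proof -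
  have "(of_real ((norm (conjugate a))\<^sup>2) :: 'a) = of_real ((norm a)\<^sup>2)"
    using mult_conjugate[of a] mult_conjugate[of "conjugate a"] by (simp add: mult.commute)
  then show ?thesis by (simp only: of_real_eq_iff power2_eq_iff_nonneg norm_ge_zero)
qed

lemma conjugate_of_real [simp]:
  "conjugate (of_real r) = (of_real r :: 'a :: norm_conjugate_field)"
proof (cases "r = 0")
  case False
  have "of_real r * conjugate (of_real r) = (of_real r * of_real r :: 'a)"
    using mult_conjugate[of "of_real r :: 'a"] by (simp add: power2_eq_square)
  then show ?thesis using False by simp
qed simp

section \<open>Width-two decompositions\<close>

lemma self_outer_sum_carrier:
  assumes "set vs \<subseteq> carrier_vec n"
  shows "self_outer_sum n vs \<in> carrier_mat n n"
  using assms by (induction vs) (auto simp: self_outer_sum_def self_outer_def)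

lemma self_outer_sum_index:
  assumes "set vs \<subseteq> carrier_vec n" "i < n" "j < n"
  shows "self_outer_sum n vs $$ (i, j) = (\<Sum>v\<leftarrow>vs. v $ i * conjugate (v $ j))"
  using assms
proof (induction vs)
  case Nil
  then show ?case by (simp add: self_outer_sum_def)
next
  case (Cons v vs)
  have "self_outer_sum n (v # vs) = self_outer v + self_outer_sum n vs"
    by (simp add: self_outer_sum_def)
  moreover have "self_outer_sum n vs \<in> carrier_mat n n"
    using Cons.prems by (intro self_outer_sum_carrier) auto
  ultimately show ?case using Cons by (auto simp: self_outer_def)
qed

lemma width_decomp_index:
  assumes "width_decomp k A vs" "i < dim_row A" "j < dim_row A"
  shows "A $$ (i, j) = (\<Sum>l<length vs. vs ! l $ i * conjugate (vs ! l $ j))"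
proof -
  have "A $$ (i, j) = self_outer_sum (dim_row A) vs $$ (i, j)"
    using assms(1) by (metis width_decomp_def)
  then show ?thesis using assms
    by (subst (asm) self_outer_sum_index)
      (auto simp: width_decomp_def sum_list_sum_nth atLeast0LessThan)
qed

lemma width_decomp_hermitian:
  fixes A :: "'a :: norm_conjugate_field mat"
  assumes "width_decomp k A vs" "i < dim_row A" "j < dim_row A"
  shows "A $$ (j, i) = conjugate (A $$ (i, j))"
  using assms(2,3)
  by (simp add: width_decomp_index[OF assms(1)] sum_conjugate conjugate_dist_mul mult.commute)

lemma vec_nnz_two_unique:
  assumes "vec_nnz v \<le> 2" "i < dim_vec v" "j < dim_vec v" "k < dim_vec v"
    and "v $ i \<noteq> 0" "v $ j \<noteq> 0" "v $ k \<noteq> 0" "i \<noteq> j" "i \<noteq> k"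
  shows "j = k"
proof (rule ccontr)
  assume "j \<noteq> k"
  then have "card {i, j, k} = 3" using assms by simp
  moreover have "card {i, j, k} \<le> vec_nnz v"
    unfolding vec_nnz_def using assms by (intro card_mono) auto
  ultimately show False using assms by simp
qed

text \<open>
  Every non-zero entry above the diagonal receives a contribution from some vector \<open>v\<close>, and the
  entries to which \<open>v\<close> can contribute, collected in \<open>S v\<close>, are at most one in number.
\<close>
lemma nnzu_le_length_width_decomp:
  assumes "width_decomp 2 A vs" "A \<in> carrier_mat n n"
  shows "nnzu A \<le> length vs"
proof -
  define S where "S v = {(i, j). i < j \<and> j < n \<and> v $ i \<noteq> 0 \<and> v $ j \<noteq> 0}" for v :: "'a vec"
  have fin: "finite (S v)" for v
    by (rule finite_subset[of _ "{..<n} \<times> {..<n}"]) (auto simp: S_def)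
  have S: "card (S v) \<le> 1" if "v \<in> set vs" for v
  proof -
    have v: "dim_vec v = n" "vec_nnz v \<le> 2" using assms that by (auto simp: width_decomp_def)
    have "e = e'" if "e \<in> S v" "e' \<in> S v" for e e'
    proof -
      obtain i j i' j' where e: "e = (i, j)" "e' = (i', j')" by fastforce
      have h: "i < j" "j < n" "i' < j'" "j' < n" "v $ i \<noteq> 0" "v $ j \<noteq> 0" "v $ i' \<noteq> 0" "v $ j' \<noteq> 0"
        using that by (auto simp: e S_def)
      have u: "b = c" if "a < n" "b < n" "c < n" "v $ a \<noteq> 0" "v $ b \<noteq> 0" "v $ c \<noteq> 0" "a \<noteq> b" "a \<noteq> c"
        for a b c using vec_nnz_two_unique[of v a b c] v that by simp
      have "i' = i \<or> i' = j" using u[of i j i'] h by auto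
      moreover have "j' = i \<or> j' = j" using u[of i j j'] h by auto
      ultimately show ?thesis using h e by auto
    qed
    then show ?thesis using fin by (simp add: card_le_Suc0_iff_eq)
  qed
  have "{(i, j). i < j \<and> i < dim_row A \<and> j < dim_col A \<and> A $$ (i, j) \<noteq> 0} \<subseteq> (\<Union>v\<in>set vs. S v)"
  proof clarsimp
    fix i j assume ij: "i < j" "i < dim_row A" "j < dim_col A" "A $$ (i, j) \<noteq> 0"
    then have "(\<Sum>l<length vs. vs ! l $ i * conjugate (vs ! l $ j)) \<noteq> 0"
      using width_decomp_index[OF assms(1), of i j] assms(2) by auto
    then obtain l where "l < length vs" "vs ! l $ i * conjugate (vs ! l $ j) \<noteq> 0"
      by (meson lessThan_iff sum.neutral)
    then show "\<exists>v\<in>set vs. (i, j) \<in> S v"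
      using ij assms(2) by (intro bexI[of _ "vs ! l"]) (auto simp: S_def)
  qed
  then have "nnzu A \<le> card (\<Union>v\<in>set vs. S v)"
    unfolding nnzu_def using fin by (intro card_mono) auto
  also have "\<dots> \<le> (\<Sum>v\<in>set vs. card (S v))" by (rule card_UN_le) simp
  also have "\<dots> \<le> (\<Sum>v\<in>set vs. 1)" using S by (intro sum_mono)
  also have "\<dots> \<le> length vs" by (simp add: card_length)
  finally show ?thesis .
qed

text \<open>
  The share at \<open>i\<close> of the edge \<open>{i, j}\<close> is what the vectors that contribute to that edge add to
  the diagonal entry at \<open>i\<close>.  The products of the shares dominate by the Cauchy--Schwarz
  inequality, and no vector is counted for two different edges at \<open>i\<close>.
\<close>
lemma width_decomp_edge_split:
  fixes A :: "'a :: norm_conjugate_field mat"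
  assumes dec: "width_decomp 2 A vs" and A: "A \<in> carrier_mat n n"
  obtains y where "edge_split {..<n} (\<lambda>i j. (norm (A $$ (i, j)))\<^sup>2) y"
    "\<And>i. i < n \<Longrightarrow> share_total {..<n} y i \<le> norm (A $$ (i, i))"
proof -
  let ?m = "length vs"
  \<comment> \<open>A vector enters \<open>x i j\<close> only if its entry at \<open>j\<close> is non-zero, and its summand vanishes if
    its entry at \<open>i\<close> does.\<close>
  define w where "w l i = norm (vs ! l $ i)" for l i
  define x where "x i j = (\<Sum>l<?m. if vs ! l $ j = 0 then 0 else (w l i)\<^sup>2)" for i j
  have idx: "A $$ (i, j) = (\<Sum>l<?m. vs ! l $ i * conjugate (vs ! l $ j))" if "i < n" "j < n" for i j
    using width_decomp_index[OF dec] A that by auto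
  have diag: "norm (A $$ (i, i)) = (\<Sum>l<?m. (w l i)\<^sup>2)" if "i < n" for i
  proof -
    have "A $$ (i, i) = of_real (\<Sum>l<?m. (w l i)\<^sup>2)"
      using idx[OF that that] by (simp add: mult_conjugate w_def)
    then show ?thesis by (simp only: norm_of_real) (simp add: sum_nonneg)
  qed
  have cs: "(norm (A $$ (i, j)))\<^sup>2 \<le> x i j * x j i" if "i < n" "j < n" for i j
  proof -
    let ?f = "\<lambda>l. if vs ! l $ j = 0 then 0 else w l i"
    let ?g = "\<lambda>l. if vs ! l $ i = 0 then 0 else w l j"
    have "norm (A $$ (i, j)) \<le> (\<Sum>l<?m. ?f l * ?g l)"
      unfolding idx[OF that] by (rule sum_norm_le) (auto simp: norm_mult w_def)
    then have "(norm (A $$ (i, j)))\<^sup>2 \<le> (\<Sum>l<?m. ?f l * ?g l)\<^sup>2"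
      by (intro power_mono) auto
    also have "\<dots> \<le> (\<Sum>l<?m. (?f l)\<^sup>2) * (\<Sum>l<?m. (?g l)\<^sup>2)"
      by (rule Cauchy_Schwarz_ineq_sum)
    also have "(\<Sum>l<?m. (?f l)\<^sup>2) = x i j" unfolding x_def by (intro sum.cong) auto
    also have "(\<Sum>l<?m. (?g l)\<^sup>2) = x j i" unfolding x_def by (intro sum.cong) auto
    finally show ?thesis .
  qed
  have tot: "share_total {..<n} x i \<le> norm (A $$ (i, i))" if i: "i < n" for i
  proof -
    have "share_total {..<n} x i =
        (\<Sum>l<?m. \<Sum>j\<in>{..<n} - {i}. if vs ! l $ j = 0 then 0 else (w l i)\<^sup>2)"
      unfolding share_total_def x_def by (rule sum.swap)
    also have "\<dots> \<le> (\<Sum>l<?m. (w l i)\<^sup>2)"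
    proof (rule sum_mono)
      fix l assume "l \<in> {..<?m}"
      then have v: "dim_vec (vs ! l) = n" "vec_nnz (vs ! l) \<le> 2"
        using dec A by (auto simp: width_decomp_def)
      let ?J = "{j \<in> {..<n} - {i}. vs ! l $ j \<noteq> 0}"
      have eq: "(\<Sum>j\<in>{..<n} - {i}. if vs ! l $ j = 0 then 0 else (w l i)\<^sup>2) = card ?J * (w l i)\<^sup>2"
      proof -
        have "(\<Sum>j\<in>{..<n} - {i}. if vs ! l $ j = 0 then 0 else (w l i)\<^sup>2) = (\<Sum>j\<in>?J. (w l i)\<^sup>2)"
          by (intro sum.mono_neutral_cong_right) auto
        then show ?thesis by simp
      qed
      show "(\<Sum>j\<in>{..<n} - {i}. if vs ! l $ j = 0 then 0 else (w l i)\<^sup>2) \<le> (w l i)\<^sup>2"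
      proof (cases "vs ! l $ i = 0")
        case True
        then show ?thesis by (simp add: w_def)
      next
        case False
        then have "card ?J \<le> 1"
          using vec_nnz_two_unique[of "vs ! l" i] v i by (auto simp: card_le_Suc0_iff_eq)
        then show ?thesis unfolding eq by (intro mult_left_le_one_le) auto
      qed
    qed
    finally show ?thesis using diag[OF i] by simp
  qed
  have sym: "norm (A $$ (i, j)) = norm (A $$ (j, i))" if "i < n" "j < n" for i j
    using width_decomp_hermitian[OF dec, of i j] A that by simp
  obtain y where "edge_split {..<n} (\<lambda>i j. (norm (A $$ (i, j)))\<^sup>2) y"
    "\<And>i. i \<in> {..<n} \<Longrightarrow> share_total {..<n} y i \<le> share_total {..<n} x i"
    by (rule edge_split_below[of "{..<n}" x "\<lambda>i j. (norm (A $$ (i, j)))\<^sup>2"])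
      (use cs sym in \<open>auto simp: x_def intro: sum_nonneg\<close>)
  then show ?thesis using that tot by fastforce
qed

text \<open>
  The vector of the edge \<open>{p, q}\<close> has entries of modulus \<open>sqrt (y p q)\<close> and \<open>sqrt (y q p)\<close>, and
  its phase is chosen such that it contributes \<open>A p q\<close> off the diagonal.
\<close>
definition edge_vec :: "'a :: norm_conjugate_field mat \<Rightarrow> (nat \<Rightarrow> nat \<Rightarrow> real) \<Rightarrow> nat \<times> nat \<Rightarrow> 'a vec" where
  "edge_vec A y = (\<lambda>(p, q). vec (dim_row A) (\<lambda>i.
     if i = p then of_real (sqrt (y p q))
     else if i = q then conjugate (A $$ (p, q)) * of_real (inverse (sqrt (y p q)))
     else 0))"

lemma vec_nnz_edge_vec: "vec_nnz (edge_vec A y (p, q)) \<le> 2"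
proof -
  have "vec_nnz (edge_vec A y (p, q)) \<le> card {p, q}"
    unfolding vec_nnz_def by (intro card_mono) (auto simp: edge_vec_def split: if_splits)
  also have "\<dots> \<le> 2" by (simp add: card_insert_if)
  finally show ?thesis .
qed

lemma width_decomp_of_edge_split:
  fixes A :: "'a :: norm_conjugate_field mat"
  assumes A: "A \<in> carrier_mat n n"
    and herm: "\<And>i j. i < n \<Longrightarrow> j < n \<Longrightarrow> A $$ (j, i) = conjugate (A $$ (i, j))"
    and split: "edge_split {..<n} (\<lambda>i j. (norm (A $$ (i, j)))\<^sup>2) y"
    and diag: "\<And>i. i < n \<Longrightarrow> A $$ (i, i) = of_real (share_total {..<n} y i)"
  obtains vs where "width_decomp 2 A vs" "length vs = nnzu A"
proof -
  define E where "E = {(i, j). i < j \<and> i < dim_row A \<and> j < dim_col A \<and> A $$ (i, j) \<noteq> 0}"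
  have E: "(p, q) \<in> E \<longleftrightarrow> p < q \<and> q < n \<and> A $$ (p, q) \<noteq> 0" for p q
    using A by (auto simp: E_def)
  have "finite E"
    by (rule finite_subset[of _ "{..<n} \<times> {..<n}"]) (use A in \<open>auto simp: E_def\<close>)
  then obtain es where es: "set es = E" "distinct es"
    using finite_distinct_list by blast
  define vs where "vs = map (edge_vec A y) es"
  have len: "length vs = nnzu A"
    using es distinct_card[OF es(2)] by (simp add: vs_def nnzu_def E_def)
  have pos: "0 < y p q \<and> y p q * y q p = (norm (A $$ (p, q)))\<^sup>2"
    if "p < n" "q < n" "p \<noteq> q" "A $$ (p, q) \<noteq> 0" for p q
  proof -
    have "0 \<le> y p q \<and> y p q * y q p = (norm (A $$ (p, q)))\<^sup>2"
      using split that unfolding edge_split_def by blast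
    moreover from this that have "y p q \<noteq> 0" by auto
    ultimately show ?thesis by simp
  qed
  have zero: "y p q = 0" if "p < n" "q < n" "p \<noteq> q" "A $$ (p, q) = 0" for p q
    using split that unfolding edge_split_def by (metis lessThan_iff norm_zero zero_power2)
  have carrier: "set vs \<subseteq> carrier_vec n"
    using A by (auto simp: vs_def edge_vec_def)
  have index: "edge_vec A y (p, q) $ i =
      (if i = p then of_real (sqrt (y p q))
       else if i = q then conjugate (A $$ (p, q)) * of_real (inverse (sqrt (y p q))) else 0)"
    if "i < n" for i p q
    using A that by (simp add: edge_vec_def)
  have norm_index: "(norm (edge_vec A y (p, q) $ i))\<^sup>2 =
      (if i = p then y p q else if i = q then y q p else 0)"
    if "i < n" "(p, q) \<in> E" for i p q
  proof -
    have y_pq: "0 < y p q" "y p q * y q p = (norm (A $$ (p, q)))\<^sup>2"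
      using pos[of p q] that E by auto
    have "(norm (conjugate (A $$ (p, q)) * of_real (inverse (sqrt (y p q)))))\<^sup>2 =
        (norm (A $$ (p, q)))\<^sup>2 / y p q"
      using y_pq(1) by (simp add: norm_mult norm_inverse power_mult_distrib power_inverse divide_inverse)
    also have "\<dots> = y q p"
      unfolding y_pq(2)[symmetric] using y_pq(1) by simp
    finally show ?thesis
      using y_pq(1) by (simp add: index[OF that(1)])
  qed
  have sum: "self_outer_sum n vs $$ (i, j) =
      (\<Sum>e\<in>E. edge_vec A y e $ i * conjugate (edge_vec A y e $ j))" if "i < n" "j < n" for i j
    using self_outer_sum_index[OF carrier that] es
    by (simp add: vs_def comp_def sum_list_distinct_conv_sum_set)
  have off: "self_outer_sum n vs $$ (i, j) = A $$ (i, j)" if ij: "i < n" "j < n" "i \<noteq> j" for i j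
  proof -
    let ?e = "(min i j, max i j)"
    have "self_outer_sum n vs $$ (i, j) =
        (\<Sum>e\<in>E. if e = ?e then edge_vec A y e $ i * conjugate (edge_vec A y e $ j) else 0)"
      unfolding sum[OF ij(1,2)]
    proof (intro sum.cong refl)
      fix e assume "e \<in> E"
      then show "edge_vec A y e $ i * conjugate (edge_vec A y e $ j) =
          (if e = ?e then edge_vec A y e $ i * conjugate (edge_vec A y e $ j) else 0)"
        using ij by (cases e) (auto simp: index E min_def max_def)
    qed
    also have "\<dots> = (if ?e \<in> E then edge_vec A y ?e $ i * conjugate (edge_vec A y ?e $ j) else 0)"
      using \<open>finite E\<close> by simp
    also have "\<dots> = A $$ (i, j)"
    proof (cases "A $$ (i, j) = 0")
      case True
      then show ?thesis using herm[OF ij(1,2)] ij by (auto simp: E min_def max_def)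
    next
      case False
      then have "A $$ (j, i) \<noteq> 0" using herm[OF ij(2,1)] by auto
      then have "0 < y i j" "0 < y j i" using pos ij False by auto
      then have r: "of_real (sqrt (y i j)) \<noteq> (0 :: 'a)" "of_real (sqrt (y j i)) \<noteq> (0 :: 'a)"
        by auto
      have conj_inv: "conjugate (inverse (of_real t)) = (inverse (of_real t) :: 'a)" for t
        by (metis conjugate_of_real of_real_inverse)
      show ?thesis
        using ij False \<open>A $$ (j, i) \<noteq> 0\<close> r herm[OF ij(2,1)]
        by (auto simp: E index min_def max_def conjugate_dist_mul conj_inv)
    qed
    finally show ?thesis .
  qed
  have on: "self_outer_sum n vs $$ (i, i) = A $$ (i, i)" if i: "i < n" for i
  proof -
    let ?N = "{j \<in> {..<n} - {i}. A $$ (i, j) \<noteq> 0}"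
    let ?s = "\<lambda>(p, q). if i = p then y p q else if i = q then y q p else 0"
    have nz: "A $$ (j, i) \<noteq> 0 \<longleftrightarrow> A $$ (i, j) \<noteq> 0" if "j < n" for j
      using herm[of i j] herm[of j i] i that by auto
    have "self_outer_sum n vs $$ (i, i) = of_real (\<Sum>e\<in>E. (norm (edge_vec A y e $ i))\<^sup>2)"
      using sum[OF i i] by (simp add: mult_conjugate)
    also have "(\<Sum>e\<in>E. (norm (edge_vec A y e $ i))\<^sup>2) = (\<Sum>e\<in>E. ?s e)"
      using norm_index[OF i] by (intro sum.cong) auto
    also have "\<dots> = (\<Sum>e\<in>{e \<in> E. i = fst e \<or> i = snd e}. ?s e)"
      using \<open>finite E\<close> by (intro sum.mono_neutral_right) (auto split: if_splits)
    also have "\<dots> = (\<Sum>j\<in>?N. y i j)"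
      by (rule sum.reindex_bij_witness[of _ "\<lambda>j. (min i j, max i j)"
            "\<lambda>(p, q). if i = p then q else p"])
        (use i nz in \<open>auto simp: E min_def max_def split: if_splits\<close>)
    also have "\<dots> = share_total {..<n} y i"
      unfolding share_total_def using zero i by (intro sum.mono_neutral_left) auto
    finally show ?thesis using diag[OF i] by simp
  qed
  have "A = self_outer_sum n vs"
    using A self_outer_sum_carrier[OF carrier] off on
    by (intro eq_matI) (metis carrier_matD)+
  moreover have "vec_nnz v \<le> 2" if "v \<in> set vs" for v
    using that vec_nnz_edge_vec by (auto simp: vs_def)
  ultimately have "width_decomp 2 A vs"
    using A carrier by (auto simp: width_decomp_def)
  then show ?thesis using len that by blast
qed

section \<open>The factor-width-two rank\<close>

lemma width_decomp_of_factor_width: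
  assumes "factor_width A = enat k"
  shows "\<exists>vs. width_decomp k A vs"
proof -
  let ?S = "{enat k | k. 1 \<le> k \<and> (\<exists>vs. width_decomp k A vs)}"
  have "?S \<noteq> {}"
  proof
    assume "?S = {}"
    then have "factor_width A = \<infinity>" by (simp only: factor_width_def Inf_enat_def refl if_True)
    with assms show False by simp
  qed
  then obtain a where "a \<in> ?S" by blast
  then have "(LEAST x. x \<in> ?S) \<in> ?S" by (rule LeastI)
  then have "Inf ?S \<in> ?S" using \<open>?S \<noteq> {}\<close> by (simp only: Inf_enat_def if_False)
  then have "enat k \<in> ?S" using assms by (simp only: factor_width_def)
  then show ?thesis by blast
qed

lemma submatrix_entry_in_elements:
  assumes "A \<in> carrier_mat n n" "I \<subseteq> {..<n}" "i \<in> I" "j \<in> I"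
  shows "A $$ (i, j) \<in> elements_mat (submatrix A I I)"
proof -
  have I: "{a. a < n \<and> a \<in> I} = I" using assms(2) by auto
  have dim: "submatrix A I I \<in> carrier_mat (card I) (card I)"
    using assms(1) by (intro carrier_matI) (simp_all add: dim_submatrix I)
  have lt: "card {a \<in> I. a < b} < card I" if "b \<in> I" for b
    using assms(2) that by (intro psubset_card_mono) (auto dest: finite_subset)
  have "submatrix A I I $$ (card {a \<in> I. a < i}, card {a \<in> I. a < j}) = A $$ (i, j)"
    using assms by (intro submatrix_index_card) auto
  from elements_matI[OF dim lt[OF assms(3)] lt[OF assms(4)] this[symmetric]]
  show ?thesis .
qed

lemma diag_in_full_principal3_triangle:
  assumes "A \<in> carrier_mat n n" "diag_in_full_principal3 A i"
  shows "\<exists>j<n. \<exists>k<n. i \<noteq> j \<and> i \<noteq> k \<and> j \<noteq> k \<and>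
    A $$ (i, j) \<noteq> 0 \<and> A $$ (i, k) \<noteq> 0 \<and> A $$ (j, k) \<noteq> 0"
proof -
  obtain I where I: "I \<subseteq> {..<n}" "card I = 3" "i \<in> I" "0 \<notin> elements_mat (submatrix A I I)"
    using assms by (auto simp: diag_in_full_principal3_def)
  have nz: "A $$ (a, b) \<noteq> 0" if "a \<in> I" "b \<in> I" for a b
    using submatrix_entry_in_elements[OF assms(1) I(1) that] I(4) by auto
  have "card (I - {i}) = 2" using I by simp
  then obtain j k where "I - {i} = {j, k}" "j \<noteq> k" by (auto simp: card_2_iff)
  then have "j \<in> I" "k \<in> I" "i \<noteq> j" "i \<noteq> k" by auto
  then show ?thesis using nz I \<open>j \<noteq> k\<close> by blast
qed

lemma fran_two_eq_nnzu:
  fixes A :: "'a :: norm_conjugate_field mat"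
  assumes A: "A \<in> carrier_mat n n" and "factor_width A = 2"
    and full: "\<And>i. i < n \<Longrightarrow> diag_in_full_principal3 A i"
  shows "fran 2 A = enat (nnzu A)"
proof (rule antisym)
  have "factor_width A = enat 2" using assms(2) by (simp add: numeral_eq_enat)
  from width_decomp_of_factor_width[OF this] obtain us where us: "width_decomp 2 A us" ..
  have herm: "A $$ (j, i) = conjugate (A $$ (i, j))" if "i < n" "j < n" for i j
    by (rule width_decomp_hermitian[OF us]) (use A that in auto)
  let ?c = "\<lambda>i j. (norm (A $$ (i, j)))\<^sup>2"
  have sym: "?c i j = ?c j i" if "i \<in> {..<n}" "j \<in> {..<n}" for i j
    using herm[of i j] that by simp
  obtain x where x: "edge_split {..<n} ?c x"
    "\<And>i. i < n \<Longrightarrow> share_total {..<n} x i \<le> norm (A $$ (i, i))"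
    using width_decomp_edge_split[OF us A] by blast
  obtain y where y: "edge_split {..<n} ?c y"
    "\<And>i. i \<in> {..<n} \<Longrightarrow> share_total {..<n} y i = norm (A $$ (i, i))"
  proof (rule edge_split_exact_totals[OF _ x(1), of "\<lambda>i. norm (A $$ (i, i))"])
    show "\<exists>j\<in>{..<n}. \<exists>k\<in>{..<n}. i \<noteq> j \<and> i \<noteq> k \<and> j \<noteq> k \<and>
      ?c i j \<noteq> 0 \<and> ?c i k \<noteq> 0 \<and> ?c j k \<noteq> 0" if "i \<in> {..<n}" for i
      using diag_in_full_principal3_triangle[OF A full[of i]] that by auto
  qed (use x(2) sym in auto)
  have "A $$ (i, i) = of_real (norm (A $$ (i, i)))" if "i < n" for i
  proof -
    have "A $$ (i, i) = of_real (\<Sum>l<length us. (norm (us ! l $ i))\<^sup>2)"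
      using width_decomp_index[OF us, of i i] A that by (simp add: mult_conjugate)
    then show ?thesis by (metis (no_types, lifting) abs_of_nonneg norm_of_real sum_nonneg zero_le_power2)
  qed
  then have diag: "A $$ (i, i) = of_real (share_total {..<n} y i)" if "i < n" for i
    using y(2) that by simp
  obtain vs where vs: "width_decomp 2 A vs" "length vs = nnzu A"
    using width_decomp_of_edge_split[OF A herm y(1) diag] by blast
  then show "fran 2 A \<le> enat (nnzu A)"
    unfolding fran_def by (intro Inf_lower) (metis (mono_tags, lifting) mem_Collect_eq)
  show "enat (nnzu A) \<le> fran 2 A"
    unfolding fran_def using nnzu_le_length_width_decomp A by (intro Inf_greatest) auto
qed

theorem theorem4:
  fixes n :: nat
  assumes "n \<ge> 3"
  shows
    "(\<forall>A :: real mat. A \<in> psd_mats n \<and> factor_width A = 2 \<and>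
        (\<forall>i < n. diag_in_full_principal3 A i) \<longrightarrow> fran 2 A = enat (nnzu A)) \<and>
     (\<forall>A :: complex mat. A \<in> psd_mats n \<and> factor_width A = 2 \<and>
        (\<forall>i < n. diag_in_full_principal3 A i) \<longrightarrow> fran 2 A = enat (nnzu A))"
  by (intro conjI allI impI; rule fran_two_eq_nnzu) (auto simp: psd_mats_def)

end
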